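(* Let $(\mathcal A,U,\Omega)$ be a conformal net on $S^1$ and let $\rho,\sigma$ be DHR representations of $\mathcal A$ on $\mathcal H_0$ localized respectively in $I_1,I_2\in\mathcal I$ (i.e. $\rho_{I_1'}=\mathrm{id}$ on $\mathcal A(I_1')$ and $\sigma_{I_2'}=\mathrm{id}$ on $\mathcal A(I_2')$), with $I_1\cup I_2\subset I$ for some $I\in\mathcal I$. For $\gamma\in\overline{\mathrm{Diff}_+(S^1)}$ let $z_\sigma(\gamma):=U(\gamma)U_\sigma(\gamma)^*$ and $z_\rho(\gamma):=U(\gamma)U_\rho(\gamma)^*$ be the covariance cocycles, where $U$, $U_\sigma$, $U_\rho$ are the multiplier representations of $\overline{\mathrm{Diff}_+(S^1)}$ on $\mathcal H_0$ described in the context. Then: 1. (covariance cocycle identity) $z_\sigma(\gamma_1\gamma_2)=U(\gamma_1)z_\sigma(\gamma_2)U(\gamma_1)^*\cdot z_\sigma(\gamma_1)$ for all $\gamma_1,\gamma_2\in\overline{\mathrm{Diff}_+(S^1)}$; 2. (naturality) for every intertwiner $V$ between $\rho$ and $\sigma$ (i.e. $V\in\mathcal B(\mathcal H_0)$ with $V\rho_J(x)=\sigma_J(x)V$ for all $J\in\mathcal I$, $x\in\mathcal A(J)$) and every $\gamma\in\overline{\mathrm{Diff}_+(S^1)}$, $$z_\sigma(\gamma)\,V=V^\gamma\,z_\rho(\gamma),\qquad V^\gamma:=U(\gamma)VU(\gamma)^*.$$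
   Context: **Conformal nets.** $\mathcal I$ is the set of non-empty open non-dense intervals of $S^1$; $I'$ is the interior of $S^1\setminus I$. A conformal net $(\mathcal A,U,\Omega)$ consists of von Neumann algebras $\mathcal A(I)$, $I\in\mathcal I$, on a separable complex Hilbert space $\mathcal H_0$, a unit vector $\Omega\in\mathcal H_0$, and a strongly continuous projective unitary representation $U$ of $\mathrm{Diff}_+(S^1)$ (orientation-preserving diffeomorphisms) on $\mathcal H_0$ which restricts to a true strongly continuous unitary representation of $\mathrm{PSL}(2,\mathbb R)$ (Möbius transformations), such that: (isotony) $I_1\subset I_2\Rightarrow\mathcal A(I_1)\subset\mathcal A(I_2)$; (locality) $I_1\cap I_2=\emptyset\Rightarrow\mathcal A(I_1)\subset\mathcal A(I_2)'$; (covariance) $U(\gamma)\mathcal A(I)U(\gamma)^{-1}=\mathcal A(\gamma I)$ for all $\gamma\in\mathrm{Diff}_+(S^1)$, and $U(\gamma)xU(\gamma)^{-1}=x$ for $x\in\mathcal A(I)$, $\gamma\in\mathrm{Diff}_+(S^1)$ with support in $I'$; (positive energy) the generator of rotations is $\ge 0$; (vacuum) $\Omega$ is, up to a phase, the unique $\mathrm{PSL}(2,\mathbb R)$-invariant unit vector and $(\bigvee_{I}\mathcal A(I))\Omega$ is dense in $\mathcal H_0$. Each $\mathcal A(I)$ is then a type III factor and Haag duality $\mathcal A(I)'=\mathcal A(I')$ holds. **DHR representations.** A DHR representation $\rho=\{\rho_I\}_{I\in\mathcal I}$ of $\mathcal A$ is a family of normal unital representations $\rho_I:\mathcal A(I)\to\mathcal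 B(\mathcal H_\rho)$ on a fixed Hilbert space with $\rho_{I_2}|_{\mathcal A(I_1)}=\rho_{I_1}$ whenever $I_1\subset I_2$. Here $\mathcal H_\rho=\mathcal H_\sigma=\mathcal H_0$. **Groups.** $\overline{\mathrm{Diff}_+(S^1)}=\{\gamma\in C^\infty(\mathbb R,\mathbb R):\gamma(t+2\pi)=\gamma(t)+2\pi,\ \gamma'>0\}$ is the universal cover of $\mathrm{Diff}_+(S^1)$, with the topology of uniform convergence of all derivatives. The support of a diffeomorphism is the closure of the set of points it moves; $\mathrm{Diff}_+(I)$ is the group of diffeomorphisms supported in $I$, regarded also as a subgroup of $\overline{\mathrm{Diff}_+(S^1)}$ (lifts fixing the preimage of $S^1\setminus I$ pointwise). $\mathsf{Vir}=\mathbb R\times\overline{\mathrm{Diff}_+(S^1)}$ with $(a_1,\gamma_1)(a_2,\gamma_2)=(a_1+a_2+\mathbf B(\gamma_1,\gamma_2),\gamma_1\circ\gamma_2)$, $\mathbf B(\gamma_1,\gamma_2)=-\frac1{48\pi}\int_0^{2\pi}\log((\gamma_1\circ\gamma_2)'(t))\frac{\gamma_2''(t)}{\gamma_2'(t)}dt$. The projective representation $U$ lifts to a strongly continuous unitary representation $\tilde U$ of $\mathsf{Vir}$ with $\mathbb R$ acting by scalars; write $U(\gamma)=\tilde U(0,\gamma)$ for $\gamma\in\overline{\mathrm{Diff}_+(S^1)}$, a multiplier representation with cocycle $c$: $U(\gamma)U(\gamma')=c(\gamma,\gamma')U(\gamma\gamma')$. One has $U(\mathrm{Diff}_+(I))\subset\mathcal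 A(I)$. **The representation $U_\sigma$ for a DHR representation $\sigma$.** Fix proper open intervals $K_j=(a_j,b_j)$, $j=1,2,3$, covering $S^1$, with angular coordinates $0<a_1<b_3<a_2<b_1<a_3<b_2<2\pi$ ($K_3\ni 0$), and continuous maps $\Xi_j$ on a neighbourhood of $e\in\overline{\mathrm{Diff}_+(S^1)}$ with $\Xi_j(e)=e$, $\Xi_j(\gamma)\in\mathrm{Diff}_+(K_j)$ and $\gamma=\Xi_1(\gamma)\Xi_2(\gamma)\Xi_3(\gamma)$. For $\gamma$ near $e$ and $\gamma_j=\Xi_j(\gamma)$ put $$U_\sigma(\gamma)=\sigma_{K_1}(U(\gamma_1))\sigma_{K_2}(U(\gamma_2))\sigma_{K_3}(U(\gamma_3))\,c(\gamma_1,\gamma_2)^{-1}c(\gamma_1\gamma_2,\gamma_3)^{-1}.$$ Near $e$ this is a local multiplier representation with the same cocycle $c$; together with the scalars $\tilde U(a,e)$, $a\in\mathbb R$, it extends (uniquely) to a strongly continuous unitary representation $\tilde U_\sigma$ of $\mathsf{Vir}$, and $U_\sigma(\gamma):=\tilde U_\sigma(0,\gamma)$ defines $U_\sigma$ on all of $\overline{\mathrm{Diff}_+(S^1)}$, a multiplier representation with cocycle $c$. It satisfies $U_\sigma(\gamma)=\sigma_J(U(\gamma))$ for $\gamma\in\mathrm{Diff}_+(J)$, $J\in\mathcal I$. $U_\rho$ is defined in the same way. *)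

theory Defs
  imports "HOL-Analysis.Analysis"
begin

subsection \<open>Complex Hilbert spaces and operators\<close>

text \<open>The complex inner product is antilinear in the first argument. The underlying real
  Hilbert space (norm, topology, completeness) is the one given by its real part.\<close>

class complex_hilbert = real_inner + complete_space +
  fixes scaleC :: "complex \<Rightarrow> 'a \<Rightarrow> 'a" (infixr "*\<^sub>C" 75)
    and cinner :: "'a \<Rightarrow> 'a \<Rightarrow> complex"
  assumes scaleC_add_right: "c *\<^sub>C (x + y) = c *\<^sub>C x + c *\<^sub>C y"
    and scaleC_add_left: "(c + d) *\<^sub>C x = c *\<^sub>C x + d *\<^sub>C x"
    and scaleC_scaleC: "c *\<^sub>C d *\<^sub>C x = (c * d) *\<^sub>C x"
    and scaleR_scaleC: "r *\<^sub>R x = complex_of_real r *\<^sub>C x"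
    and cinner_commute: "cinner x y = cnj (cinner y x)"
    and cinner_add_right: "cinner x (y + z) = cinner x y + cinner x z"
    and cinner_scaleC_right: "cinner x (c *\<^sub>C y) = c * cinner x y"
    and inner_cinner: "inner x y = Re (cinner x y)"

instantiation complex :: complex_hilbert
begin
definition "scaleC_complex (c::complex) (x::complex) = c * x"
definition "cinner_complex (x::complex) (y::complex) = cnj x * y"
instance
  by standard
    (auto simp: scaleC_complex_def cinner_complex_def algebra_simps inner_complex_def
      scaleR_conv_of_real)
end

text \<open>Operators are functions on the Hilbert space. The topology of the function type
  (pointwise convergence) restricts to the strong operator topology.\<close>

definition bounded_ops :: "('h::complex_hilbert \<Rightarrow> 'h) set" where
  "bounded_ops = {f. bounded_linear f \<and> (\<forall>c x. f (c *\<^sub>C x) = c *\<^sub>C f x)}"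

definition cadj :: "('h::complex_hilbert \<Rightarrow> 'h) \<Rightarrow> ('h \<Rightarrow> 'h)" where
  "cadj f = (THE g. \<forall>x y. cinner (f x) y = cinner x (g y))"

definition scale_op :: "complex \<Rightarrow> ('h::complex_hilbert \<Rightarrow> 'h) \<Rightarrow> ('h \<Rightarrow> 'h)" where
  "scale_op c f = (\<lambda>x. c *\<^sub>C f x)"

definition unitary :: "('h::complex_hilbert \<Rightarrow> 'h) \<Rightarrow> bool" where
  "unitary f \<longleftrightarrow> f \<in> bounded_ops \<and> surj f \<and> (\<forall>x y. cinner (f x) (f y) = cinner x y)"

definition commutant :: "('h::complex_hilbert \<Rightarrow> 'h) set \<Rightarrow> ('h \<Rightarrow> 'h) set" where
  "commutant S = {x \<in> bounded_ops. \<forall>y\<in>S. x \<circ> y = y \<circ> x}"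

definition von_neumann_algebra :: "('h::complex_hilbert \<Rightarrow> 'h) set \<Rightarrow> bool" where
  "von_neumann_algebra M \<longleftrightarrow>
     M \<subseteq> bounded_ops \<and> (\<forall>x\<in>M. cadj x \<in> M) \<and> commutant (commutant M) = M"

definition self_adjoint_ops :: "('h::complex_hilbert \<Rightarrow> 'h) set" where
  "self_adjoint_ops = {x \<in> bounded_ops. cadj x = x}"

definition op_le :: "('h::complex_hilbert \<Rightarrow> 'h) \<Rightarrow> ('h \<Rightarrow> 'h) \<Rightarrow> bool" where
  "op_le x y \<longleftrightarrow> (\<forall>\<psi>. Re (cinner \<psi> (x \<psi>)) \<le> Re (cinner \<psi> (y \<psi>)))"

definition op_sup :: "('h::complex_hilbert \<Rightarrow> 'h) set \<Rightarrow> ('h \<Rightarrow> 'h) \<Rightarrow> bool" where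
  "op_sup D x \<longleftrightarrow> x \<in> self_adjoint_ops \<and> (\<forall>d\<in>D. op_le d x) \<and>
     (\<forall>y\<in>self_adjoint_ops. (\<forall>d\<in>D. op_le d y) \<longrightarrow> op_le x y)"

text \<open>Normality is preservation of suprema of bounded upward directed families of
  self-adjoint operators; such suprema exist in B(H) and belong to the algebra.\<close>

definition normal_map ::
  "('h::complex_hilbert \<Rightarrow> 'h) set \<Rightarrow> (('h \<Rightarrow> 'h) \<Rightarrow> ('h \<Rightarrow> 'h)) \<Rightarrow> bool" where
  "normal_map M \<phi> \<longleftrightarrow>
     (\<forall>D x. D \<subseteq> M \<inter> self_adjoint_ops \<and> D \<noteq> {} \<and>
        (\<forall>d\<in>D. \<forall>d'\<in>D. \<exists>d''\<in>D. op_le d d'' \<and> op_le d' d'') \<and> op_sup D x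
        \<longrightarrow> op_sup (\<phi> ` D) (\<phi> x))"

definition normal_representation ::
  "('h::complex_hilbert \<Rightarrow> 'h) set \<Rightarrow> (('h \<Rightarrow> 'h) \<Rightarrow> ('h \<Rightarrow> 'h)) \<Rightarrow> bool" where
  "normal_representation M \<phi> \<longleftrightarrow>
     (\<forall>x\<in>M. \<phi> x \<in> bounded_ops) \<and>
     (\<forall>x\<in>M. \<forall>y\<in>M. \<phi> (\<lambda>\<psi>. x \<psi> + y \<psi>) = (\<lambda>\<psi>. \<phi> x \<psi> + \<phi> y \<psi>)) \<and>
     (\<forall>c. \<forall>x\<in>M. \<phi> (scale_op c x) = scale_op c (\<phi> x)) \<and>
     (\<forall>x\<in>M. \<forall>y\<in>M. \<phi> (x \<circ> y) = \<phi> x \<circ> \<phi> y) \<and>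
     (\<forall>x\<in>M. \<phi> (cadj x) = cadj (\<phi> x)) \<and>
     \<phi> id = id \<and> normal_map M \<phi>"


subsection \<open>The universal cover of the diffeomorphism group of the circle\<close>

definition smooth :: "(real \<Rightarrow> real) \<Rightarrow> bool" where
  "smooth f \<longleftrightarrow> (\<forall>n t. (deriv ^^ n) f differentiable (at t))"

definition Diff_cover :: "(real \<Rightarrow> real) set" where
  "Diff_cover = {\<gamma>. smooth \<gamma> \<and> (\<forall>t. \<gamma> (t + 2 * pi) = \<gamma> t + 2 * pi) \<and> (\<forall>t. deriv \<gamma> t > 0)}"

definition diff_open :: "(real \<Rightarrow> real) set \<Rightarrow> bool" where
  "diff_open W \<longleftrightarrow> W \<subseteq> Diff_cover \<and>
     (\<forall>\<gamma>\<in>W. \<exists>n. \<exists>\<epsilon>>0. \<forall>\<eta>\<in>Diff_cover.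
        (\<forall>k\<le>n. \<forall>t. \<bar>(deriv ^^ k) \<eta> t - (deriv ^^ k) \<gamma> t\<bar> < \<epsilon>) \<longrightarrow> \<eta> \<in> W)"

definition diff_cover_topology :: "(real \<Rightarrow> real) topology" where
  "diff_cover_topology = topology diff_open"

lemma diff_openD:
  assumes "diff_open W" "\<gamma> \<in> W"
  obtains n \<epsilon> where "\<epsilon> > 0" "\<And>\<eta>. \<eta> \<in> Diff_cover \<Longrightarrow>
    (\<And>k t. k \<le> n \<Longrightarrow> \<bar>(deriv ^^ k) \<eta> t - (deriv ^^ k) \<gamma> t\<bar> < \<epsilon>) \<Longrightarrow> \<eta> \<in> W"
proof -
  have "\<exists>n. \<exists>\<epsilon>>0. \<forall>\<eta>\<in>Diff_cover.
        (\<forall>k\<le>n. \<forall>t. \<bar>(deriv ^^ k) \<eta> t - (deriv ^^ k) \<gamma> t\<bar> < \<epsilon>) \<longrightarrow> \<eta> \<in> W"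
    using assms unfolding diff_open_def by (elim conjE) (erule (1) bspec)
  then show thesis
    by (elim exE conjE) (rule that, assumption, blast)
qed

lemma istopology_diff_open: "istopology diff_open"
  unfolding istopology_def
proof (intro conjI allI impI)
  fix S T assume ST: "diff_open S" "diff_open T"
  show "diff_open (S \<inter> T)"
    unfolding diff_open_def
  proof (intro conjI ballI)
    show "S \<inter> T \<subseteq> Diff_cover"
      using ST by (auto simp: diff_open_def)
    fix \<gamma> assume "\<gamma> \<in> S \<inter> T"
    then have "\<gamma> \<in> S" "\<gamma> \<in> T"
      by auto
    from diff_openD[OF ST(1) this(1)] obtain n \<epsilon> where n: "\<epsilon> > 0"
      "\<And>\<eta>. \<eta> \<in> Diff_cover \<Longrightarrow>
        (\<And>k t. k \<le> n \<Longrightarrow> \<bar>(deriv ^^ k) \<eta> t - (deriv ^^ k) \<gamma> t\<bar> < \<epsilon>) \<Longrightarrow> \<eta> \<in> S"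
      by metis
    from diff_openD[OF ST(2) \<open>\<gamma> \<in> T\<close>] obtain m \<delta> where m: "\<delta> > 0"
      "\<And>\<eta>. \<eta> \<in> Diff_cover \<Longrightarrow>
        (\<And>k t. k \<le> m \<Longrightarrow> \<bar>(deriv ^^ k) \<eta> t - (deriv ^^ k) \<gamma> t\<bar> < \<delta>) \<Longrightarrow> \<eta> \<in> T"
      by metis
    show "\<exists>n. \<exists>\<epsilon>>0. \<forall>\<eta>\<in>Diff_cover.
        (\<forall>k\<le>n. \<forall>t. \<bar>(deriv ^^ k) \<eta> t - (deriv ^^ k) \<gamma> t\<bar> < \<epsilon>) \<longrightarrow> \<eta> \<in> S \<inter> T"
    proof (intro exI[of _ "max n m"] exI[of _ "min \<epsilon> \<delta>"] conjI ballI impI)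
      fix \<eta> assume \<eta>: "\<eta> \<in> Diff_cover"
        "\<forall>k\<le>max n m. \<forall>t. \<bar>(deriv ^^ k) \<eta> t - (deriv ^^ k) \<gamma> t\<bar> < min \<epsilon> \<delta>"
      have "\<eta> \<in> S"
        by (rule n(2)) (use \<eta> in \<open>simp_all add: le_max_iff_disj\<close>)
      moreover have "\<eta> \<in> T"
        by (rule m(2)) (use \<eta> in \<open>simp_all add: le_max_iff_disj\<close>)
      ultimately show "\<eta> \<in> S \<inter> T" ..
    qed (use n(1) m(1) in simp)
  qed
next
  fix \<K> assume K: "\<forall>S\<in>\<K>. diff_open S"
  show "diff_open (\<Union>\<K>)"
    unfolding diff_open_def
  proof (intro conjI ballI)
    show "\<Union>\<K> \<subseteq> Diff_cover"
      using K by (auto simp: diff_open_def)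
    fix \<gamma> assume "\<gamma> \<in> \<Union>\<K>"
    then obtain S where S: "S \<in> \<K>" "\<gamma> \<in> S"
      by auto
    with K have "diff_open S"
      by auto
    from diff_openD[OF this S(2)] obtain n \<epsilon> where n: "\<epsilon> > 0"
      "\<And>\<eta>. \<eta> \<in> Diff_cover \<Longrightarrow>
        (\<And>k t. k \<le> n \<Longrightarrow> \<bar>(deriv ^^ k) \<eta> t - (deriv ^^ k) \<gamma> t\<bar> < \<epsilon>) \<Longrightarrow> \<eta> \<in> S"
      by metis
    show "\<exists>n. \<exists>\<epsilon>>0. \<forall>\<eta>\<in>Diff_cover.
        (\<forall>k\<le>n. \<forall>t. \<bar>(deriv ^^ k) \<eta> t - (deriv ^^ k) \<gamma> t\<bar> < \<epsilon>) \<longrightarrow> \<eta> \<in> \<Union>\<K>"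
    proof (intro exI[of _ n] exI[of _ \<epsilon>] conjI ballI impI)
      fix \<eta> assume "\<eta> \<in> Diff_cover"
        "\<forall>k\<le>n. \<forall>t. \<bar>(deriv ^^ k) \<eta> t - (deriv ^^ k) \<gamma> t\<bar> < \<epsilon>"
      then have "\<eta> \<in> S"
        by (intro n(2)) simp_all
      with S(1) show "\<eta> \<in> \<Union>\<K>" by (rule UnionI)
    qed (rule n(1))
  qed
qed

lemma openin_diff_cover: "openin diff_cover_topology W \<longleftrightarrow> diff_open W"
  unfolding diff_cover_topology_def by (simp add: istopology_diff_open topology_inverse')


subsection \<open>The circle, its intervals and its diffeomorphisms\<close>

abbreviation S1 :: "complex set" where "S1 \<equiv> sphere 0 1"

definition circle_arc :: "real \<Rightarrow> real \<Rightarrow> complex set" where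
  "circle_arc a b = cis ` {a<..<b}"

definition intervals :: "complex set set" where
  "intervals = {I. openin (top_of_set S1) I \<and> connected I \<and> I \<noteq> {} \<and> closure I \<noteq> S1}"

definition opposite :: "complex set \<Rightarrow> complex set" where
  "opposite I = top_of_set S1 interior_of (S1 - I)"

text \<open>Maps of the circle are extensional functions, so that they are determined by their
  values on the circle and composed by \<^const>\<open>compose\<close>. The covering map sends
  \<open>\<gamma>\<close> to \<open>cis t \<mapsto> cis (\<gamma> t)\<close>, and
  the topology of the diffeomorphism group is the quotient topology.\<close>

definition circle_map :: "(real \<Rightarrow> real) \<Rightarrow> (complex \<Rightarrow> complex)" where
  "circle_map \<gamma> = (\<lambda>z\<in>S1. cis (\<gamma> (Arg z)))"

definition Diff_circle :: "(complex \<Rightarrow> complex) set" where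
  "Diff_circle = circle_map ` Diff_cover"

definition diff_circle_topology :: "(complex \<Rightarrow> complex) topology" where
  "diff_circle_topology =
     topology (\<lambda>W. W \<subseteq> Diff_circle \<and>
       openin diff_cover_topology {\<gamma> \<in> Diff_cover. circle_map \<gamma> \<in> W})"

lemma openin_diff_circle:
  "openin diff_circle_topology W \<longleftrightarrow>
     W \<subseteq> Diff_circle \<and> openin diff_cover_topology {\<gamma> \<in> Diff_cover. circle_map \<gamma> \<in> W}"
proof -
  let ?L = "\<lambda>W. W \<subseteq> Diff_circle \<and>
       openin diff_cover_topology {\<gamma> \<in> Diff_cover. circle_map \<gamma> \<in> W}"
  have "istopology ?L"
    unfolding istopology_def
  proof (intro conjI allI impI)
    fix S T assume S: "?L S" and T: "?L T"
    then show "S \<inter> T \<subseteq> Diff_circle"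
      by auto
    have "{\<gamma> \<in> Diff_cover. circle_map \<gamma> \<in> S \<inter> T}
        = {\<gamma> \<in> Diff_cover. circle_map \<gamma> \<in> S} \<inter> {\<gamma> \<in> Diff_cover. circle_map \<gamma> \<in> T}"
      by auto
    then show "openin diff_cover_topology {\<gamma> \<in> Diff_cover. circle_map \<gamma> \<in> S \<inter> T}"
      using S T by (simp only: openin_Int)
  next
    fix \<K> assume K: "\<forall>S\<in>\<K>. ?L S"
    then show "\<Union>\<K> \<subseteq> Diff_circle"
      by auto
    have "{\<gamma> \<in> Diff_cover. circle_map \<gamma> \<in> \<Union>\<K>}
        = (\<Union>S\<in>\<K>. {\<gamma> \<in> Diff_cover. circle_map \<gamma> \<in> S})"
      by auto
    with K show "openin diff_cover_topology {\<gamma> \<in> Diff_cover. circle_map \<gamma> \<in> \<Union>\<K>}"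
      by auto
  qed
  then show ?thesis
    unfolding diff_circle_topology_def by (simp add: topology_inverse')
qed

definition support :: "(complex \<Rightarrow> complex) \<Rightarrow> complex set" where
  "support g = closure {z \<in> S1. g z \<noteq> z}"

definition Diff_supported :: "complex set \<Rightarrow> (complex \<Rightarrow> complex) set" where
  "Diff_supported I = {g \<in> Diff_circle. support g \<subseteq> I}"

definition Diff_supported_lift :: "complex set \<Rightarrow> (real \<Rightarrow> real) set" where
  "Diff_supported_lift I =
     {\<gamma> \<in> Diff_cover. circle_map \<gamma> \<in> Diff_supported I \<and> (\<forall>t. cis t \<notin> I \<longrightarrow> \<gamma> t = t)}"

text \<open>PSL(2,R) acts on the circle as PSU(1,1).\<close>

definition Moebius :: "(complex \<Rightarrow> complex) set" where
  "Moebius = {(\<lambda>z\<in>S1. (\<alpha> * z + \<beta>) / (cnj \<beta> * z + cnj \<alpha>)) |\<alpha> \<beta>.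
     (cmod \<alpha>)\<^sup>2 - (cmod \<beta>)\<^sup>2 = 1}"

definition rotation :: "real \<Rightarrow> (complex \<Rightarrow> complex)" where
  "rotation \<theta> = (\<lambda>z\<in>S1. cis \<theta> * z)"


subsection \<open>Conformal nets\<close>

text \<open>A projective unitary representation is given by a choice of unitary representatives.
  Its continuity is continuity into the quotient of the unitary group, with the strong
  operator topology, by the phases: the open sets of the quotient are the phase-invariant
  strongly open sets.\<close>

definition projective_rep :: "((complex \<Rightarrow> complex) \<Rightarrow> ('h::complex_hilbert \<Rightarrow> 'h)) \<Rightarrow> bool" where
  "projective_rep U \<longleftrightarrow>
     (\<forall>g\<in>Diff_circle. unitary (U g)) \<and>
     (\<forall>g\<in>Diff_circle. \<forall>h\<in>Diff_circle. \<exists>\<mu>. cmod \<mu> = 1 \<and>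
        U g \<circ> U h = scale_op \<mu> (U (compose S1 g h))) \<and>
     (\<forall>W. open W \<and> (\<forall>u\<in>W. \<forall>\<mu>. cmod \<mu> = 1 \<longrightarrow> scale_op \<mu> u \<in> W) \<longrightarrow>
        openin diff_circle_topology {g \<in> Diff_circle. U g \<in> W})"

text \<open>\<open>(\<psi>, \<eta>)\<close> is in the graph of the self-adjoint generator
  \<open>L\<close> of \<open>W t = exp (i t L)\<close>.\<close>

definition in_generator ::
  "(real \<Rightarrow> ('h::complex_hilbert \<Rightarrow> 'h)) \<Rightarrow> 'h \<Rightarrow> 'h \<Rightarrow> bool" where
  "in_generator W \<psi> \<eta> \<longleftrightarrow> ((\<lambda>t. (W t \<psi> - \<psi>) /\<^sub>R t) \<longlongrightarrow> \<i> *\<^sub>C \<eta>) (at 0)"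

locale conformal_net =
  fixes A :: "complex set \<Rightarrow> ('h::{complex_hilbert, second_countable_topology} \<Rightarrow> 'h) set"
    and U :: "(complex \<Rightarrow> complex) \<Rightarrow> ('h \<Rightarrow> 'h)"
    and \<Omega> :: 'h
  assumes von_neumann: "I \<in> intervals \<Longrightarrow> von_neumann_algebra (A I)"
    and vacuum_unit: "norm \<Omega> = 1"
    and projective: "projective_rep U"
    and Moebius_rep:
      "g \<in> Moebius \<Longrightarrow> h \<in> Moebius \<Longrightarrow> U (compose S1 g h) = U g \<circ> U h"
    and Moebius_continuous:
      "continuous_map (subtopology diff_circle_topology Moebius) euclidean U"
    and isotony: "I1 \<in> intervals \<Longrightarrow> I2 \<in> intervals \<Longrightarrow> I1 \<subseteq> I2 \<Longrightarrow> A I1 \<subseteq> A I2"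
    and locality:
      "I1 \<in> intervals \<Longrightarrow> I2 \<in> intervals \<Longrightarrow> I1 \<inter> I2 = {} \<Longrightarrow> A I1 \<subseteq> commutant (A I2)"
    and covariance:
      "g \<in> Diff_circle \<Longrightarrow> I \<in> intervals \<Longrightarrow> (\<lambda>x. U g \<circ> x \<circ> inv (U g)) ` A I = A (g ` I)"
    and local_action:
      "I \<in> intervals \<Longrightarrow> g \<in> Diff_circle \<Longrightarrow> support g \<subseteq> opposite I \<Longrightarrow> x \<in> A I
         \<Longrightarrow> U g \<circ> x \<circ> inv (U g) = x"
    and positive_energy:
      "in_generator (\<lambda>t. U (rotation t)) \<psi> \<eta> \<Longrightarrow> 0 \<le> Re (cinner \<psi> \<eta>)"
    and vacuum_invariant: "g \<in> Moebius \<Longrightarrow> U g \<Omega> = \<Omega>"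
    and vacuum_unique:
      "norm \<psi> = 1 \<Longrightarrow> (\<And>g. g \<in> Moebius \<Longrightarrow> U g \<psi> = \<psi>)
         \<Longrightarrow> \<exists>\<mu>. cmod \<mu> = 1 \<and> \<psi> = \<mu> *\<^sub>C \<Omega>"
    and vacuum_cyclic:
      "closure ((\<lambda>x. x \<Omega>) ` commutant (commutant (\<Union>I\<in>intervals. A I))) = UNIV"


subsection \<open>DHR representations on the vacuum Hilbert space\<close>

text \<open>\<open>\<rho> I\<close> is only meaningful on \<open>A I\<close>.\<close>

definition DHR_representation ::
  "(complex set \<Rightarrow> ('h::complex_hilbert \<Rightarrow> 'h) set)
     \<Rightarrow> (complex set \<Rightarrow> ('h \<Rightarrow> 'h) \<Rightarrow> ('h \<Rightarrow> 'h)) \<Rightarrow> bool" where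
  "DHR_representation A \<rho> \<longleftrightarrow>
     (\<forall>I\<in>intervals. normal_representation (A I) (\<rho> I)) \<and>
     (\<forall>I1\<in>intervals. \<forall>I2\<in>intervals. I1 \<subseteq> I2 \<longrightarrow> (\<forall>x\<in>A I1. \<rho> I2 x = \<rho> I1 x))"

definition localized_in ::
  "(complex set \<Rightarrow> ('h::complex_hilbert \<Rightarrow> 'h) set)
     \<Rightarrow> (complex set \<Rightarrow> ('h \<Rightarrow> 'h) \<Rightarrow> ('h \<Rightarrow> 'h)) \<Rightarrow> complex set \<Rightarrow> bool" where
  "localized_in A \<rho> I \<longleftrightarrow> (\<forall>x\<in>A (opposite I). \<rho> (opposite I) x = x)"

definition intertwiner ::
  "(complex set \<Rightarrow> ('h::complex_hilbert \<Rightarrow> 'h) set)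
     \<Rightarrow> (complex set \<Rightarrow> ('h \<Rightarrow> 'h) \<Rightarrow> ('h \<Rightarrow> 'h))
     \<Rightarrow> (complex set \<Rightarrow> ('h \<Rightarrow> 'h) \<Rightarrow> ('h \<Rightarrow> 'h)) \<Rightarrow> ('h \<Rightarrow> 'h) \<Rightarrow> bool" where
  "intertwiner A \<rho> \<sigma> V \<longleftrightarrow>
     V \<in> bounded_ops \<and> (\<forall>J\<in>intervals. \<forall>x\<in>A J. V \<circ> \<rho> J x = \<sigma> J x \<circ> V)"


subsection \<open>The group Vir and its representations\<close>

definition bott :: "(real \<Rightarrow> real) \<Rightarrow> (real \<Rightarrow> real) \<Rightarrow> real" where
  "bott \<gamma>1 \<gamma>2 = - (1 / (48 * pi)) *
     integral {0..2 * pi} (\<lambda>t. ln (deriv (\<gamma>1 \<circ> \<gamma>2) t) * (deriv (deriv \<gamma>2) t / deriv \<gamma>2 t))"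

definition Vir :: "(real \<times> (real \<Rightarrow> real)) set" where
  "Vir = UNIV \<times> Diff_cover"

definition vir_mult ::
  "real \<times> (real \<Rightarrow> real) \<Rightarrow> real \<times> (real \<Rightarrow> real) \<Rightarrow> real \<times> (real \<Rightarrow> real)" where
  "vir_mult x y = (fst x + fst y + bott (snd x) (snd y), snd x \<circ> snd y)"

definition vir_rep :: "(real \<times> (real \<Rightarrow> real) \<Rightarrow> ('h::complex_hilbert \<Rightarrow> 'h)) \<Rightarrow> bool" where
  "vir_rep R \<longleftrightarrow>
     (\<forall>x\<in>Vir. unitary (R x)) \<and>
     (\<forall>x\<in>Vir. \<forall>y\<in>Vir. R (vir_mult x y) = R x \<circ> R y) \<and>
     continuous_map (prod_topology euclidean diff_cover_topology) euclidean R"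

definition vir_lift ::
  "((complex \<Rightarrow> complex) \<Rightarrow> ('h::complex_hilbert \<Rightarrow> 'h))
     \<Rightarrow> (real \<times> (real \<Rightarrow> real) \<Rightarrow> ('h \<Rightarrow> 'h)) \<Rightarrow> bool" where
  "vir_lift U R \<longleftrightarrow> vir_rep R \<and>
     (\<forall>a. \<exists>\<mu>. cmod \<mu> = 1 \<and> R (a, id) = scale_op \<mu> id) \<and>
     (\<forall>a. \<forall>\<gamma>\<in>Diff_cover. \<exists>\<mu>. cmod \<mu> = 1 \<and> R (a, \<gamma>) = scale_op \<mu> (U (circle_map \<gamma>)))"

definition multiplier_rep ::
  "(real \<times> (real \<Rightarrow> real) \<Rightarrow> ('h::complex_hilbert \<Rightarrow> 'h)) \<Rightarrow> (real \<Rightarrow> real) \<Rightarrow> ('h \<Rightarrow> 'h)" where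
  "multiplier_rep R \<gamma> = R (0, \<gamma>)"

definition multiplier ::
  "((real \<Rightarrow> real) \<Rightarrow> ('h::complex_hilbert \<Rightarrow> 'h))
     \<Rightarrow> (real \<Rightarrow> real) \<Rightarrow> (real \<Rightarrow> real) \<Rightarrow> complex" where
  "multiplier T \<gamma> \<gamma>' = (THE c. T \<gamma> \<circ> T \<gamma>' = scale_op c (T (\<gamma> \<circ> \<gamma>')))"


subsection \<open>The representation of Vir associated with a DHR representation\<close>

text \<open>The third interval contains the angle 0, so it is \<open>(a 3, b 3 + 2 * pi)\<close>
  as an interval of angles.\<close>

definition cover_interval :: "(nat \<Rightarrow> real) \<Rightarrow> (nat \<Rightarrow> real) \<Rightarrow> nat \<Rightarrow> complex set" where
  "cover_interval a b j = (if j = 3 then circle_arc (a 3) (b 3 + 2 * pi) else circle_arc (a j) (b j))"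

definition local_factorization ::
  "(nat \<Rightarrow> real) \<Rightarrow> (nat \<Rightarrow> real) \<Rightarrow> (nat \<Rightarrow> (real \<Rightarrow> real) \<Rightarrow> (real \<Rightarrow> real)) \<Rightarrow> bool" where
  "local_factorization a b \<Xi> \<longleftrightarrow>
     0 < a 1 \<and> a 1 < b 3 \<and> b 3 < a 2 \<and> a 2 < b 1 \<and> b 1 < a 3 \<and> a 3 < b 2 \<and> b 2 < 2 * pi \<and>
     (\<exists>N. openin diff_cover_topology N \<and> id \<in> N \<and>
        (\<forall>j\<in>{1,2,3}.
           continuous_map (subtopology diff_cover_topology N) diff_cover_topology (\<Xi> j) \<and>
           \<Xi> j id = id \<and>
           (\<forall>\<gamma>\<in>N. \<Xi> j \<gamma> \<in> Diff_supported_lift (cover_interval a b j))) \<and>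
        (\<forall>\<gamma>\<in>N. \<gamma> = \<Xi> 1 \<gamma> \<circ> \<Xi> 2 \<gamma> \<circ> \<Xi> 3 \<gamma>))"

definition local_formula ::
  "(real \<times> (real \<Rightarrow> real) \<Rightarrow> ('h::complex_hilbert \<Rightarrow> 'h))
     \<Rightarrow> (nat \<Rightarrow> real) \<Rightarrow> (nat \<Rightarrow> real) \<Rightarrow> (nat \<Rightarrow> (real \<Rightarrow> real) \<Rightarrow> (real \<Rightarrow> real))
     \<Rightarrow> (complex set \<Rightarrow> ('h \<Rightarrow> 'h) \<Rightarrow> ('h \<Rightarrow> 'h)) \<Rightarrow> (real \<Rightarrow> real) \<Rightarrow> ('h \<Rightarrow> 'h)" where
  "local_formula R a b \<Xi> \<sigma> \<gamma> =
     (let T = multiplier_rep R; K = cover_interval a b;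
          \<gamma>1 = \<Xi> 1 \<gamma>; \<gamma>2 = \<Xi> 2 \<gamma>; \<gamma>3 = \<Xi> 3 \<gamma>
      in scale_op (inverse (multiplier T \<gamma>1 \<gamma>2) * inverse (multiplier T (\<gamma>1 \<circ> \<gamma>2) \<gamma>3))
           (\<sigma> (K 1) (T \<gamma>1) \<circ> \<sigma> (K 2) (T \<gamma>2) \<circ> \<sigma> (K 3) (T \<gamma>3)))"

text \<open>\<open>S\<close> is the extension to Vir of the local formula for
  \<open>\<sigma>\<close> and the scalars \<open>R (a, id)\<close>. The membership clause says
  that the local formula is defined: each \<open>\<sigma> K\<close> is a map on \<open>A K\<close> only.
  For a conformal net it always holds, since \<open>U (Diff I) \<subseteq> A I\<close>.\<close>

definition DHR_vir_rep ::
  "(complex set \<Rightarrow> ('h::complex_hilbert \<Rightarrow> 'h) set)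
     \<Rightarrow> (real \<times> (real \<Rightarrow> real) \<Rightarrow> ('h \<Rightarrow> 'h))
     \<Rightarrow> (nat \<Rightarrow> real) \<Rightarrow> (nat \<Rightarrow> real) \<Rightarrow> (nat \<Rightarrow> (real \<Rightarrow> real) \<Rightarrow> (real \<Rightarrow> real))
     \<Rightarrow> (complex set \<Rightarrow> ('h \<Rightarrow> 'h) \<Rightarrow> ('h \<Rightarrow> 'h))
     \<Rightarrow> (real \<times> (real \<Rightarrow> real) \<Rightarrow> ('h \<Rightarrow> 'h)) \<Rightarrow> bool" where
  "DHR_vir_rep A R a b \<Xi> \<sigma> S \<longleftrightarrow>
     vir_rep S \<and> (\<forall>s. S (s, id) = R (s, id)) \<and>
     (\<exists>N. openin diff_cover_topology N \<and> id \<in> N \<and>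
        (\<forall>\<gamma>\<in>N. (\<forall>j\<in>{1,2,3}. multiplier_rep R (\<Xi> j \<gamma>) \<in> A (cover_interval a b j)) \<and>
                multiplier_rep S \<gamma> = local_formula R a b \<Xi> \<sigma> \<gamma>))"

definition covariance_cocycle ::
  "((real \<Rightarrow> real) \<Rightarrow> ('h::complex_hilbert \<Rightarrow> 'h)) \<Rightarrow> ((real \<Rightarrow> real) \<Rightarrow> ('h \<Rightarrow> 'h))
     \<Rightarrow> (real \<Rightarrow> real) \<Rightarrow> ('h \<Rightarrow> 'h)" where
  "covariance_cocycle T T\<sigma> \<gamma> = T \<gamma> \<circ> cadj (T\<sigma> \<gamma>)"

end

theory Submission
  imports Defs
begin

text \<open>The multiplier representations \<open>U\<close> and \<open>U\<^sub>\<sigma>\<close> have the same scalar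
  multiplier, which cancels in \<open>U U\<^sub>\<sigma>\<^sup>*\<close>; this gives the cocycle identity. Naturality
  amounts to \<open>V U\<^sub>\<rho>(\<gamma>) = U\<^sub>\<sigma>(\<gamma>) V\<close>. Near the identity this is visible from the
  local formula, each factor of which is intertwined by \<open>V\<close>. The set of \<open>\<gamma>\<close> with this
  property absorbs a neighbourhood of the identity, and the universal cover is connected by
  straight segments, so it is everything.\<close>

section \<open>Adjoints of unitary operators\<close>

lemma cinner_eqI:
  fixes y z :: "'h::complex_hilbert"
  assumes "\<And>x. cinner x y = cinner x z"
  shows "y = z"
proof -
  have "inner x y = inner x z" for x :: 'h
    by (simp add: inner_cinner assms)
  then show ?thesis
    using vector_eq_ldot[of y z] by simp
qed

lemma unitary_bij:
  assumes "unitary f"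
  shows "bij f"
proof -
  interpret bounded_linear f
    using assms by (simp add: unitary_def bounded_ops_def)
  have "x = 0" if "f x = 0" for x
  proof -
    have "inner x x = inner (f x) (f x)"
      using assms by (simp add: unitary_def inner_cinner)
    then show ?thesis using that by simp
  qed
  then have "inj f"
    by (simp add: inj_iff_eq_0 linear_axioms linear_injective_0)
  then show ?thesis
    using assms by (simp add: bij_def unitary_def)
qed

text \<open>\<open>cadj\<close> is a definite description, so existence and uniqueness are both due:
  the inverse is an adjoint by surjectivity and preservation of \<open>cinner\<close>, and
  nondegeneracy makes it the only one. Every adjoint in the theorem is that of a unitary.\<close>

lemma cadj_unitary:
  assumes "unitary f"
  shows "cadj f = inv f"
  unfolding cadj_def
proof (rule the_equality)
  have surj: "surj f" and pres: "\<And>x y. cinner (f x) (f y) = cinner x y"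
    using assms by (auto simp: unitary_def)
  show adj: "\<forall>x y. cinner (f x) y = cinner x (inv f y)"
  proof (intro allI)
    fix x y
    have "cinner (f x) (f (inv f y)) = cinner x (inv f y)"
      by (rule pres)
    then show "cinner (f x) y = cinner x (inv f y)"
      by (simp add: surj_f_inv_f[OF surj])
  qed
  fix g assume g: "\<forall>x y. cinner (f x) y = cinner x (g y)"
  show "g = inv f"
  proof
    fix y
    have "cinner x (g y) = cinner x (inv f y)" for x
      using adj g by simp
    then show "g y = inv f y"
      by (rule cinner_eqI)
  qed
qed

section \<open>Smooth functions on the line\<close>

text \<open>Cutting smoothness off at finite order opens its closure properties to induction: each
  differentiation rule leads to functions of one order less.\<close>

definition differentiable_upto :: "nat \<Rightarrow> (real \<Rightarrow> real) \<Rightarrow> bool" where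
  "differentiable_upto k f \<longleftrightarrow> (\<forall>n<k. \<forall>t. (deriv ^^ n) f differentiable (at t))"

lemma smooth_iff_differentiable_upto: "smooth f \<longleftrightarrow> (\<forall>k. differentiable_upto k f)"
  by (auto simp: smooth_def differentiable_upto_def)

lemma differentiable_upto_0 [simp]: "differentiable_upto 0 f"
  by (simp add: differentiable_upto_def)

lemma differentiable_upto_Suc:
  "differentiable_upto (Suc k) f \<longleftrightarrow>
     (\<forall>t. f differentiable (at t)) \<and> differentiable_upto k (deriv f)"
  by (auto simp: differentiable_upto_def All_less_Suc2 funpow_Suc_right simp del: funpow.simps)

lemma differentiable_upto_SucD: "differentiable_upto (Suc k) f \<Longrightarrow> differentiable_upto k f"
  by (simp add: differentiable_upto_def)

lemma differentiable_upto_SucI: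
  assumes "\<And>t. (f has_real_derivative f' t) (at t)" "differentiable_upto k f'"
  shows "differentiable_upto (Suc k) f"
proof -
  have "deriv f = f'"
    using assms(1) by (intro ext DERIV_imp_deriv)
  then show ?thesis
    using assms by (auto simp: differentiable_upto_Suc real_differentiable_def)
qed

lemma differentiable_DERIV_deriv:
  fixes f :: "real \<Rightarrow> real"
  shows "f differentiable (at t) \<Longrightarrow> (f has_real_derivative deriv f t) (at t)"
  by (auto simp: real_differentiable_def DERIV_imp_deriv)

lemma smooth_deriv: "smooth f \<Longrightarrow> smooth (deriv f)"
  using differentiable_upto_Suc smooth_iff_differentiable_upto by blast

lemma smooth_DERIV: "smooth f \<Longrightarrow> (f has_real_derivative deriv f t) (at t)"
  using differentiable_upto_Suc smooth_iff_differentiable_upto differentiable_DERIV_deriv by blast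

lemma smooth_continuous_on: "smooth f \<Longrightarrow> continuous_on S f"
  by (intro continuous_at_imp_continuous_on ballI DERIV_isCont[OF smooth_DERIV])

lemma smooth_funpow_deriv: "smooth f \<Longrightarrow> smooth ((deriv ^^ n) f)"
  by (induction n) (auto intro: smooth_deriv)

lemma differentiable_upto_const: "differentiable_upto k (\<lambda>_. c)"
proof (induction k arbitrary: c)
  case (Suc k)
  show ?case
    by (rule differentiable_upto_SucI[where f' = "\<lambda>_. 0"]) (auto intro: Suc)
qed simp

lemma smooth_ident: "smooth (\<lambda>x. x)"
  unfolding smooth_iff_differentiable_upto
proof
  \<comment> \<open>Order \<open>Suc k\<close> is proved and then lowered, which spares a case
    distinction on k.\<close>
  fix k show "differentiable_upto k (\<lambda>x. x)"
    by (rule differentiable_upto_SucD, rule differentiable_upto_SucI[where f' = "\<lambda>_. 1"])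
      (auto intro: differentiable_upto_const)
qed

text \<open>An exact formula rather than mere smoothness, because the derivatives of
  \<open>x + s * h x\<close> have to be compared with those of the identity.\<close>

lemma funpow_deriv_add_cmult:
  assumes "smooth f" "smooth g"
  shows "(deriv ^^ n) (\<lambda>x. f x + c * g x) = (\<lambda>x. (deriv ^^ n) f x + c * (deriv ^^ n) g x)"
  using assms
proof (induction n arbitrary: f g)
  case (Suc n)
  have "deriv (\<lambda>x. f x + c * g x) = (\<lambda>x. deriv f x + c * deriv g x)"
    using Suc.prems
    by (intro ext DERIV_imp_deriv DERIV_add DERIV_cmult smooth_DERIV)
  then show ?case
    using Suc by (simp add: funpow_Suc_right smooth_deriv del: funpow.simps)
qed simp

lemma smooth_add_cmult:
  assumes "smooth f" "smooth g"
  shows "smooth (\<lambda>x. f x + c * g x)"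
  unfolding smooth_def funpow_deriv_add_cmult[OF assms]
  using assms
  by (auto simp: smooth_def intro!: differentiable_add differentiable_mult differentiable_const)

section \<open>Closure of finite-order differentiability under algebra and composition\<close>

lemma differentiable_upto_add:
  "differentiable_upto k f \<Longrightarrow> differentiable_upto k g \<Longrightarrow> differentiable_upto k (\<lambda>x. f x + g x)"
proof (induction k arbitrary: f g)
  case (Suc k)
  show ?case
  proof (rule differentiable_upto_SucI)
    show "differentiable_upto k (\<lambda>x. deriv f x + deriv g x)"
      using Suc by (simp add: differentiable_upto_Suc)
    fix t show "((\<lambda>x. f x + g x) has_real_derivative deriv f t + deriv g t) (at t)"
      using Suc.prems
      by (intro DERIV_add differentiable_DERIV_deriv) (simp_all add: differentiable_upto_Suc)
  qed
qed simp

lemma differentiable_upto_mult: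
  "differentiable_upto k f \<Longrightarrow> differentiable_upto k g \<Longrightarrow> differentiable_upto k (\<lambda>x. f x * g x)"
proof (induction k arbitrary: f g)
  case (Suc k)
  \<comment> \<open>The product rule leaves one factor undifferentiated, so f and g themselves are
    lowered to order k as well.\<close>
  have "differentiable_upto k (\<lambda>x. f x * deriv g x + deriv f x * g x)"
    using Suc.prems Suc.prems[THEN differentiable_upto_SucD]
    by (intro differentiable_upto_add Suc.IH) (simp_all add: differentiable_upto_Suc)
  then show ?case
  proof (rule differentiable_upto_SucI[rotated])
    fix t show "((\<lambda>x. f x * g x) has_real_derivative f t * deriv g t + deriv f t * g t) (at t)"
      using Suc.prems
      by (intro DERIV_mult' differentiable_DERIV_deriv) (simp_all add: differentiable_upto_Suc)
  qed
qed simp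

lemma differentiable_upto_inverse:
  "differentiable_upto k f \<Longrightarrow> (\<And>x. f x \<noteq> 0) \<Longrightarrow> differentiable_upto k (\<lambda>x. inverse (f x))"
proof (induction k)
  case (Suc k)
  \<comment> \<open>The derivative of \<open>1/f\<close> contains \<open>1/f\<close> again, which
    the induction hypothesis covers at order k.\<close>
  have inv: "differentiable_upto k (\<lambda>x. inverse (f x))"
    using Suc.IH Suc.prems(2) differentiable_upto_SucD[OF Suc.prems(1)] by blast
  have "differentiable_upto k (\<lambda>x. -1 * (inverse (f x) * deriv f x * inverse (f x)))"
    using Suc.prems
    by (intro differentiable_upto_mult differentiable_upto_const inv)
      (auto simp: differentiable_upto_Suc)
  then show ?case
  proof (rule differentiable_upto_SucI[rotated])
    fix t
    have "(f has_real_derivative deriv f t) (at t)"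
      using Suc.prems by (simp add: differentiable_upto_Suc differentiable_DERIV_deriv)
    from DERIV_inverse'[OF this Suc.prems(2)]
    show "((\<lambda>x. inverse (f x)) has_real_derivative
        -1 * (inverse (f t) * deriv f t * inverse (f t))) (at t)"
      by simp
  qed
qed simp

text \<open>The chain rule replaces the outer function by its derivative and keeps g, hence the
  induction generalizes over f only.\<close>

lemma differentiable_upto_compose:
  "differentiable_upto k f \<Longrightarrow> differentiable_upto k g \<Longrightarrow> differentiable_upto k (\<lambda>x. f (g x))"
proof (induction k arbitrary: f)
  case (Suc k)
  have "differentiable_upto k (\<lambda>x. deriv f (g x) * deriv g x)"
    using Suc.prems Suc.prems[THEN differentiable_upto_SucD]
    by (intro differentiable_upto_mult Suc.IH[of "deriv f"]) (simp_all add: differentiable_upto_Suc)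
  then show ?case
  proof (rule differentiable_upto_SucI[rotated])
    fix t
    have "(f has_real_derivative deriv f (g t)) (at (g t))" "(g has_real_derivative deriv g t) (at t)"
      using Suc.prems by (simp_all add: differentiable_upto_Suc differentiable_DERIV_deriv)
    then show "((\<lambda>x. f (g x)) has_real_derivative deriv f (g t) * deriv g t) (at t)"
      by (rule DERIV_chain2)
  qed
qed simp

lemma smooth_divide:
  assumes "smooth f" "smooth g" "\<And>x. g x \<noteq> 0"
  shows "smooth (\<lambda>x. f x / g x)"
  using assms unfolding smooth_iff_differentiable_upto divide_inverse
  by (intro allI differentiable_upto_mult differentiable_upto_inverse) auto

text \<open>The functions \<open>\<phi> \<circ> f\<close> with \<open>f\<close> the inverse of \<open>g\<close> are stable
  under differentiation: \<open>(\<phi> \<circ> f)' = (\<phi>' / g') \<circ> f\<close>.\<close>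

lemma smooth_compose_inverse:
  assumes g: "smooth g" "\<And>x. deriv g x > 0" "bij g" and "smooth \<phi>"
  shows "smooth (\<lambda>x. \<phi> (inv g x))"
proof -
  have f_g: "inv g (g x) = x" and g_f: "g (inv g x) = x" for x
    using g(3) by (simp_all add: bij_is_inj bij_is_surj surj_f_inv_f)
  have cont: "isCont (inv g) y" for y
  proof -
    have "isCont (inv g) (g (inv g y))"
      by (rule isCont_inverse_function[where f = g and x = "inv g y" and d = 1])
        (auto simp: f_g intro: DERIV_isCont smooth_DERIV g)
    then show ?thesis by (simp add: g_f)
  qed
  have deriv_inv: "(inv g has_real_derivative inverse (deriv g (inv g y))) (at y)" for y
    by (rule DERIV_inverse_function[where f = g and a = "y - 1" and b = "y + 1"])
      (use g(2)[of "inv g y"] in \<open>auto simp: g_f cont intro: smooth_DERIV g(1)\<close>)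
  have "differentiable_upto k (\<lambda>x. \<phi> (inv g x))" for k
    using assms(4)
  proof (induction k arbitrary: \<phi>)
    case (Suc k)
    have "smooth (\<lambda>x. deriv \<phi> x / deriv g x)"
      using g Suc.prems by (intro smooth_divide smooth_deriv) (auto simp: less_imp_neq[THEN not_sym])
    from Suc.IH[OF this] show ?case
    proof (rule differentiable_upto_SucI[rotated])
      fix t show "((\<lambda>x. \<phi> (inv g x)) has_real_derivative
          deriv \<phi> (inv g t) / deriv g (inv g t)) (at t)"
        using DERIV_chain2[OF smooth_DERIV[OF Suc.prems] deriv_inv]
        by (simp add: divide_inverse)
    qed
  qed simp
  then show ?thesis
    by (simp add: smooth_iff_differentiable_upto)
qed

section \<open>Periodic functions and their bounds\<close>

lemma periodic_deriv:
  assumes "\<And>x::real. f (x + p) = (f x :: real)" "smooth f"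
  shows "deriv f (x + p) = deriv f x"
proof -
  have "((\<lambda>x. f (x + p)) has_real_derivative deriv f (x + p)) (at x)"
    using smooth_DERIV[OF assms(2)] DERIV_shift by blast
  then show ?thesis
    by (simp add: assms(1) DERIV_imp_deriv)
qed

lemma periodic_funpow_deriv:
  assumes "\<And>x::real. f (x + p) = (f x :: real)" "smooth f"
  shows "(deriv ^^ n) f (x + p) = (deriv ^^ n) f x"
  by (induction n arbitrary: x) (auto simp: assms intro!: periodic_deriv smooth_funpow_deriv)

text \<open>Periodicity reduces the line to a compact period. The topology of the cover compares
  derivatives uniformly on the whole line, which calls for such bounds.\<close>

lemma periodic_bounded:
  fixes f :: "real \<Rightarrow> real"
  assumes "\<And>x. f (x + 2 * pi) = f x" "continuous_on UNIV f"
  obtains M where "M > 0" "\<And>x. \<bar>f x\<bar> \<le> M"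
proof -
  interpret periodic_fun_simple f "2 * pi"
    by unfold_locales (rule assms)
  have "compact (f ` {0..2 * pi})"
    by (intro compact_continuous_image continuous_on_subset[OF assms(2)]) auto
  then obtain M where M: "M > 0" "\<And>x. x \<in> {0..2 * pi} \<Longrightarrow> \<bar>f x\<bar> \<le> M"
    using compact_imp_bounded bounded_pos by (metis image_eqI real_norm_def)
  show thesis
  proof (rule that[OF M(1)])
    fix x
    \<comment> \<open>The translate of x by whole periods that lies in
      \<open>{0..2 * pi}\<close>.\<close>
    let ?y = "x - of_int \<lfloor>x / (2 * pi)\<rfloor> * (2 * pi)"
    have "x / (2 * pi) - of_int \<lfloor>x / (2 * pi)\<rfloor> \<in> {0..1}"
      by simp linarith
    then have "?y \<in> {0..2 * pi}"
      by (auto simp: field_simps)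
    then have "\<bar>f ?y\<bar> \<le> M"
      by (rule M(2))
    then show "\<bar>f x\<bar> \<le> M"
      by (simp add: minus_of_int)
  qed
qed

section \<open>Neighbourhoods of the identity in the universal cover\<close>

lemma Diff_cover_compose:
  assumes "f \<in> Diff_cover" "g \<in> Diff_cover"
  shows "f \<circ> g \<in> Diff_cover"
proof -
  have f: "smooth f" "\<And>t. f (t + 2 * pi) = f t + 2 * pi" "\<And>t. deriv f t > 0"
    and g: "smooth g" "\<And>t. g (t + 2 * pi) = g t + 2 * pi" "\<And>t. deriv g t > 0"
    using assms by (auto simp: Diff_cover_def)
  have "smooth (f \<circ> g)"
    using f(1) g(1) by (simp add: smooth_iff_differentiable_upto differentiable_upto_compose o_def)
  moreover have "deriv (f \<circ> g) t = deriv f (g t) * deriv g t" for t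
    by (intro DERIV_imp_deriv DERIV_chain smooth_DERIV f g)
  ultimately show ?thesis
    by (simp add: Diff_cover_def f g)
qed

text \<open>A positive derivative gives injectivity. For surjectivity, the displacement
  \<open>\<gamma> x - x\<close> is periodic, hence bounded by some M, so the values at
  \<open>y - M\<close> and \<open>y + M\<close> enclose y and the intermediate value theorem
  applies.\<close>

lemma Diff_cover_bij:
  assumes "\<gamma> \<in> Diff_cover"
  shows "bij \<gamma>"
proof -
  have \<gamma>: "smooth \<gamma>" "\<And>t. \<gamma> (t + 2 * pi) = \<gamma> t + 2 * pi" "\<And>t. deriv \<gamma> t > 0"
    using assms by (auto simp: Diff_cover_def)
  have cont: "continuous_on S \<gamma>" for S
    using \<gamma>(1) by (rule smooth_continuous_on)
  have "strict_mono \<gamma>"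
    using DERIV_pos_imp_increasing smooth_DERIV[OF \<gamma>(1)] \<gamma>(3) by (metis strict_mono_def)
  then have "inj \<gamma>"
    by (rule strict_mono_imp_inj_on)
  moreover have "\<exists>x. \<gamma> x = y" for y
  proof -
    obtain M where M: "M > 0" "\<And>x. \<bar>\<gamma> x - x\<bar> \<le> M"
      by (rule periodic_bounded[of "\<lambda>x. \<gamma> x - x"]) (auto simp: \<gamma> intro!: continuous_intros cont)
    have "\<gamma> (y - M) \<le> y" "y \<le> \<gamma> (y + M)"
      using M(2)[of "y - M"] M(2)[of "y + M"] by linarith+
    then show ?thesis
      using IVT'[of \<gamma> "y - M" y "y + M"] M(1) cont by auto
  qed
  ultimately show ?thesis
    by (metis bijI surjI)
qed

lemma deriv_id_add_cmult:
  assumes "smooth h"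
  shows "deriv (\<lambda>x. x + c * h x) t = 1 + c * deriv h t"
  by (intro DERIV_imp_deriv DERIV_add DERIV_cmult DERIV_ident smooth_DERIV assms)

text \<open>The k-th derivatives of \<open>x + s * h x\<close> and of the identity differ by s times
  that of h, which is bounded by periodicity. A basic neighbourhood controls only finitely many
  orders, so one bound on s serves them all.\<close>

lemma Diff_cover_id_add_small:
  assumes h: "smooth h" "\<And>t. h (t + 2 * pi) = h t"
    and N: "openin diff_cover_topology N" "id \<in> N"
  obtains \<delta> where "\<delta> > 0" "\<And>s. \<bar>s\<bar> < \<delta> \<Longrightarrow> (\<lambda>x. x + s * h x) \<in> N"
proof -
  from N obtain n \<epsilon> where n: "\<epsilon> > 0" "\<And>\<eta>. \<eta> \<in> Diff_cover \<Longrightarrow>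
    (\<And>k t. k \<le> n \<Longrightarrow> \<bar>(deriv ^^ k) \<eta> t - (deriv ^^ k) id t\<bar> < \<epsilon>) \<Longrightarrow> \<eta> \<in> N"
    unfolding openin_diff_cover by (metis diff_openD)
  have "\<exists>M>0. \<forall>t. \<bar>(deriv ^^ k) h t\<bar> \<le> M" for k
  proof (rule periodic_bounded)
    show "(deriv ^^ k) h (x + 2 * pi) = (deriv ^^ k) h x" for x
      using h by (intro periodic_funpow_deriv)
    show "continuous_on UNIV ((deriv ^^ k) h)"
      by (intro smooth_continuous_on smooth_funpow_deriv h)
  qed blast
  then obtain M where M: "\<And>k. M k > 0" "\<And>k t. \<bar>(deriv ^^ k) h t\<bar> \<le> M k"
    by metis
  \<comment> \<open>The sum runs to \<open>Suc n\<close> so that the first derivative is covered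
    even if n is 0.\<close>
  define B where "B = (\<Sum>k\<le>Suc n. M k)"
  have M_le: "M k \<le> B" if "k \<le> Suc n" for k
    unfolding B_def using that by (intro member_le_sum) (auto intro: less_imp_le M)
  have B: "B > 0"
    using M_le[of 0] M(1)[of 0] by simp
  have bound: "\<bar>s * (deriv ^^ k) h t\<bar> < e"
    if "\<bar>s\<bar> < e / B" "k \<le> Suc n" for s k t e
  proof -
    have "\<bar>s * (deriv ^^ k) h t\<bar> \<le> \<bar>s\<bar> * B"
      unfolding abs_mult using M(2)[of k t] M_le[OF that(2)] by (intro mult_left_mono) auto
    also have "\<dots> < e"
      using that(1) B by (simp add: field_simps)
    finally show ?thesis .
  qed
  \<comment> \<open>The 1 in the minimum keeps \<open>1 + s * deriv h t\<close> positive, so that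
    the map lies in \<open>Diff_cover\<close>; the \<epsilon> gives closeness to the
    identity.\<close>
  show thesis
  proof (rule that[of "min \<epsilon> 1 / B"])
    show "min \<epsilon> 1 / B > 0"
      using n(1) B by simp
    fix s assume s: "\<bar>s\<bar> < min \<epsilon> 1 / B"
    then have s1: "\<bar>s\<bar> < 1 / B" and s\<epsilon>: "\<bar>s\<bar> < \<epsilon> / B"
      using B by (auto simp: field_simps)
    show "(\<lambda>x. x + s * h x) \<in> N"
    proof (rule n(2))
      have "0 < 1 + s * deriv h t" for t
        using bound[OF s1, of 1 t] by auto
      then show "(\<lambda>x. x + s * h x) \<in> Diff_cover"
        using h by (auto simp: Diff_cover_def smooth_ident smooth_add_cmult deriv_id_add_cmult)
      fix k t assume "k \<le> n"
      then show "\<bar>(deriv ^^ k) (\<lambda>x. x + s * h x) t - (deriv ^^ k) id t\<bar> < \<epsilon>"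
        using bound[OF s\<epsilon>, of k t]
        by (simp add: funpow_deriv_add_cmult[OF smooth_ident h(1)] id_def)
    qed
  qed
qed

text \<open>The derivative is the convex combination \<open>(1 - t) + t * deriv \<gamma> x\<close>
  of positive numbers. Its first summand is strictly positive unless t is 1, whence the case
  distinction.\<close>

lemma Diff_cover_segment:
  assumes "\<gamma> \<in> Diff_cover" "0 \<le> t" "t \<le> 1"
  shows "(\<lambda>x. x + t * (\<gamma> x - x)) \<in> Diff_cover"
proof -
  have \<gamma>: "smooth \<gamma>" "\<And>t. \<gamma> (t + 2 * pi) = \<gamma> t + 2 * pi" "\<And>t. deriv \<gamma> t > 0"
    using assms by (auto simp: Diff_cover_def)
  have h: "smooth (\<lambda>x. \<gamma> x - x)"
    using smooth_add_cmult[OF \<gamma>(1) smooth_ident, of "-1"] by simp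
  have "deriv (\<lambda>x. \<gamma> x - x) x = deriv \<gamma> x - 1" for x
    by (intro DERIV_imp_deriv DERIV_diff DERIV_ident smooth_DERIV \<gamma>)
  moreover have "0 < 1 + t * (deriv \<gamma> x - 1)" for x
  proof (cases "t = 1")
    case False
    then have "0 < (1 - t) + t * deriv \<gamma> x"
      using assms \<gamma>(3)[of x] by (intro add_pos_nonneg) auto
    then show ?thesis by (simp add: algebra_simps)
  qed (simp add: \<gamma>)
  ultimately show ?thesis
    using h by (auto simp: Diff_cover_def deriv_id_add_cmult smooth_add_cmult smooth_ident \<gamma>)
qed

lemma Diff_cover_inv_periodic:
  assumes "g \<in> Diff_cover"
  shows "inv g (t + 2 * pi) = inv g t + 2 * pi"
proof -
  have "g (inv g t + 2 * pi) = t + 2 * pi"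
    using assms Diff_cover_bij[OF assms] by (simp add: Diff_cover_def bij_is_surj surj_f_inv_f)
  then show ?thesis
    using Diff_cover_bij[OF assms] by (metis bij_inv_eq_iff)
qed

text \<open>Along the segment \<open>\<gamma>\<^sub>t = id + t (\<gamma> - id)\<close> one has
  \<open>\<gamma>\<^sub>t \<circ> \<gamma>\<^sub>s\<inverse> = id + (t - s) h\<close> with \<open>h = (\<gamma> - id) \<circ> \<gamma>\<^sub>s\<inverse>\<close>
  periodic and smooth, so that no estimate on derivatives of compositions is needed.\<close>

lemma Diff_cover_neighbourhood_induct:
  assumes \<gamma>: "\<gamma> \<in> Diff_cover"
    and N: "openin diff_cover_topology N" "id \<in> N"
    and id: "P id"
    and step: "\<And>n g. n \<in> N \<Longrightarrow> g \<in> Diff_cover \<Longrightarrow> P (n \<circ> g) \<longleftrightarrow> P g"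
  shows "P \<gamma>"
proof -
  define p where "p t = (\<lambda>x. x + t * (\<gamma> x - x))" for t
  have p: "p t \<in> Diff_cover" if "t \<in> {0..1}" for t
    using that Diff_cover_segment[OF \<gamma>] by (simp add: p_def)
  \<comment> \<open>Agreement of P at two parameters is an equivalence relation; its classes are
    shown to be open, so the connected unit interval is a single class.\<close>
  have "P (p 0) \<longleftrightarrow> P (p 1)"
  proof (rule connected_equivalence_relation[where R = "\<lambda>s t. P (p s) \<longleftrightarrow> P (p t)" and S = "{0..1::real}"])
    fix s :: real assume s: "s \<in> {0..1}"
    let ?g = "p s"
    define h where "h = (\<lambda>x. \<gamma> (inv ?g x) - inv ?g x)"
    have g: "smooth ?g" "\<And>x. deriv ?g x > 0" "bij ?g"
      using p[OF s] Diff_cover_bij by (auto simp: Diff_cover_def)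
    have "smooth (\<lambda>x. \<gamma> x - x)"
      using \<gamma> smooth_add_cmult[OF _ smooth_ident, of \<gamma> "-1"] by (simp add: Diff_cover_def)
    then have "smooth h"
      unfolding h_def by (rule smooth_compose_inverse[OF g])
    moreover have "h (t + 2 * pi) = h t" for t
      using \<gamma> by (simp add: h_def Diff_cover_inv_periodic[OF p[OF s]] Diff_cover_def)
    ultimately obtain \<delta> where \<delta>: "\<delta> > 0" "\<And>r. \<bar>r\<bar> < \<delta> \<Longrightarrow> (\<lambda>x. x + r * h x) \<in> N"
      by (rule Diff_cover_id_add_small[OF _ _ N]) blast
    have local: "P (p s) \<longleftrightarrow> P (p t)" if t: "t \<in> {0..1}" "\<bar>t - s\<bar> < \<delta>" for t
    proof -
      have "p t = (\<lambda>x. x + (t - s) * h x) \<circ> ?g"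
      proof
        fix x
        have "((\<lambda>x. x + (t - s) * h x) \<circ> ?g) x = ?g x + (t - s) * (\<gamma> x - x)"
          using g(3) by (simp add: h_def bij_is_inj)
        then show "p t x = ((\<lambda>x. x + (t - s) * h x) \<circ> ?g) x"
          by (simp add: p_def algebra_simps)
      qed
      \<comment> \<open>As \<open>step\<close> is an equivalence, P passes both ways between s and t
        without an appeal to inverses of elements of N.\<close>
      with step[OF \<delta>(2)[OF t(2)] p[OF s]] p[OF t(1)] show ?thesis
        by simp
    qed
    show "\<exists>T. openin (top_of_set {0..1}) T \<and> s \<in> T \<and> (\<forall>t\<in>T. P (p s) \<longleftrightarrow> P (p t))"
    proof (intro exI conjI ballI)
      show "openin (top_of_set {0..1}) ({0..1} \<inter> ball s \<delta>)"
        by (intro openin_open_Int open_ball)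
      show "s \<in> {0..1} \<inter> ball s \<delta>"
        using s \<delta>(1) by simp
      fix t assume "t \<in> {0..1} \<inter> ball s \<delta>"
      then show "P (p s) \<longleftrightarrow> P (p t)"
        by (intro local) (auto simp: dist_real_def)
    qed
  qed auto
  moreover have "p 0 = id" "p 1 = \<gamma>"
    by (auto simp: p_def)
  ultimately show ?thesis
    using id by simp
qed

section \<open>Arcs of the circle\<close>

lemma cis_image_Ico: "cis ` {c..<c + 2 * pi} = S1"
proof (intro equalityI subsetI)
  fix z assume "z \<in> S1"
  then have z: "z = cis (Arg z)"
    using rcis_cmod_Arg[of z] by (simp add: rcis_def)
  \<comment> \<open>The number of turns that brings \<open>Arg z\<close> into the interval; the
    ceiling fits its closed left end.\<close>
  define k where "k = \<lceil>(c - Arg z) / (2 * pi)\<rceil>"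
  have "(c - Arg z) / (2 * pi) \<le> k" "k < (c - Arg z) / (2 * pi) + 1"
    unfolding k_def by linarith+
  then have "Arg z + 2 * pi * k \<in> {c..<c + 2 * pi}"
    by (auto simp: field_simps)
  moreover have "cis (Arg z + 2 * pi * k) = z"
    by (metis cis_mult cis_multiple_2pi Ints_of_int mult.right_neutral z)
  ultimately show "z \<in> cis ` {c..<c + 2 * pi}"
    by (metis image_eqI)
qed auto

lemma cis_inj_on_Ico: "inj_on cis {c..<c + 2 * pi}"
proof (rule inj_onI)
  fix x y assume xy: "x \<in> {c..<c + 2 * pi}" "y \<in> {c..<c + 2 * pi}" "cis x = cis y"
  then have "cis (x - y) = 1"
    by (simp add: cis_divide[symmetric])
  then have "cos (x - y) = 1"
    by (simp add: complex_eq_iff)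
  then obtain k :: int where k: "x - y = of_int k * 2 * pi"
    using cos_one_2pi_int by auto
  have "\<bar>x - y\<bar> < 2 * pi"
    using xy by auto
  then have "\<bar>real_of_int k\<bar> * (2 * pi) < 1 * (2 * pi)"
    unfolding k by (simp add: abs_mult)
  then have "\<bar>real_of_int k\<bar> < 1"
    by (subst (asm) mult_less_cancel_right_pos) auto
  then have "k = 0"
    by linarith
  with k show "x = y" by simp
qed

text \<open>The arc is open because its complement in the circle is the image of the compact
  interval \<open>{d..c + 2 * pi}\<close>. Taking complements commutes with \<open>cis\<close> on a
  half-open period, where it is injective.\<close>

lemma circle_arc_in_intervals:
  assumes "c < d" "d < c + 2 * pi"
  shows "circle_arc c d \<in> intervals"
proof -
  have cpt: "compact (cis ` {x..y})" for x y
    by (intro compact_continuous_image continuous_intros) auto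
  have inj: "inj_on cis {c..<c + 2 * pi}"
    by (rule cis_inj_on_Ico)
  have "cis (c + 2 * pi) = cis c"
    by (simp add: cis.ctr)
  then have "cis ` {d..c + 2 * pi} = insert (cis c) (cis ` {d..<c + 2 * pi})"
    using assms by (simp flip: ivl_disj_un_singleton(6))
  also have "\<dots> = cis ` insert c {d..<c + 2 * pi}"
    by simp
  also have "insert c {d..<c + 2 * pi} = {c..<c + 2 * pi} - {c<..<d}"
    using assms by auto
  also have "cis ` ({c..<c + 2 * pi} - {c<..<d}) = S1 - circle_arc c d"
    unfolding circle_arc_def cis_image_Ico[of c, symmetric]
    using assms by (intro inj_on_image_set_diff[OF inj]) auto
  finally have "closedin (top_of_set S1) (S1 - circle_arc c d)"
    using cpt by (metis Diff_subset closed_subset compact_imp_closed)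
  then have open_arc: "openin (top_of_set S1) (circle_arc c d)"
    by (auto simp: openin_closedin_eq circle_arc_def)
  have conn: "connected (circle_arc c d)"
    unfolding circle_arc_def by (intro connected_continuous_image continuous_intros) auto
  have "closure (circle_arc c d) \<subseteq> cis ` {c..d}"
    unfolding circle_arc_def using cpt by (intro closure_minimal compact_imp_closed) auto
  \<comment> \<open>The midpoint of the complementary arc witnesses that the arc is not
    dense.\<close>
  moreover have "cis ((d + (c + 2 * pi)) / 2) \<in> S1 - cis ` {c..d}"
    using inj assms by (auto dest!: inj_onD)
  ultimately have "closure (circle_arc c d) \<noteq> S1"
    by blast
  with open_arc conn show ?thesis
    using assms(1) by (simp add: intervals_def circle_arc_def)
qed

text \<open>An intertwiner is constrained only at members of \<open>intervals\<close>, while the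
  local formula evaluates the representations at the cover intervals. The order of the end points
  makes each arc shorter than a full turn.\<close>

lemma cover_interval_in_intervals:
  assumes "local_factorization a b \<Xi>" "j \<in> {1, 2, 3}"
  shows "cover_interval a b j \<in> intervals"
  using assms unfolding local_factorization_def cover_interval_def
  by (auto intro!: circle_arc_in_intervals)

section \<open>Representations of Vir\<close>

text \<open>The integrand vanishes with the second derivative of the identity, so elements
  \<open>(s, id)\<close> split off on the right without a correction.\<close>

lemma bott_id_right: "bott \<gamma> id = 0"
  by (simp add: bott_def id_def)

lemma id_in_Diff_cover: "id \<in> Diff_cover"
  by (simp add: Diff_cover_def id_def smooth_ident)

lemma vir_rep_unitary: "vir_rep R \<Longrightarrow> \<gamma> \<in> Diff_cover \<Longrightarrow> unitary (R (s, \<gamma>))"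
  by (simp add: vir_rep_def Vir_def)

text \<open>Both sides are R at
  \<open>(bott \<gamma>1 \<gamma>2, \<gamma>1 \<circ> \<gamma>2)\<close>, factored in two ways. The
  multiplier stays an operator \<open>R (bott \<gamma>1 \<gamma>2, id)\<close>, so representations
  that agree on all \<open>(s, id)\<close> visibly share it.\<close>

lemma multiplier_rep_mult:
  assumes "vir_rep R" "\<gamma>1 \<in> Diff_cover" "\<gamma>2 \<in> Diff_cover"
  shows "multiplier_rep R \<gamma>1 \<circ> multiplier_rep R \<gamma>2
    = multiplier_rep R (\<gamma>1 \<circ> \<gamma>2) \<circ> R (bott \<gamma>1 \<gamma>2, id)"
proof -
  have mult: "R (vir_mult x y) = R x \<circ> R y" if "x \<in> Vir" "y \<in> Vir" for x y
    using assms(1) that by (simp add: vir_rep_def)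
  show ?thesis
    using mult[of "(0, \<gamma>1)" "(0, \<gamma>2)"] mult[of "(0, \<gamma>1 \<circ> \<gamma>2)" "(bott \<gamma>1 \<gamma>2, id)"] assms
    by (simp add: Diff_cover_compose Vir_def vir_mult_def multiplier_rep_def bott_id_right id_in_Diff_cover)
qed

lemma surj_o_cancel: "surj h \<Longrightarrow> f \<circ> h = g \<circ> h \<longleftrightarrow> f = g"
  by (metis comp_assoc comp_id surj_iff)

lemma inj_o_cancel: "inj f \<Longrightarrow> f \<circ> g = f \<circ> h \<longleftrightarrow> g = h"
  by (simp add: fun_eq_iff inj_eq)

lemma scale_op_o: "scale_op c f \<circ> g = scale_op c (f \<circ> g)"
  by (auto simp: scale_op_def)

lemma bounded_ops_o_scale_op: "V \<in> bounded_ops \<Longrightarrow> V \<circ> scale_op c f = scale_op c (V \<circ> f)"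
  by (auto simp: scale_op_def bounded_ops_def)

lemma covariance_cocycle_eq:
  assumes "vir_rep S" "\<gamma> \<in> Diff_cover"
  shows "covariance_cocycle T (multiplier_rep S) \<gamma> = T \<gamma> \<circ> inv (multiplier_rep S \<gamma>)"
  using assms by (simp add: covariance_cocycle_def multiplier_rep_def cadj_unitary vir_rep_unitary)

text \<open>Both formulas use the same factors \<open>\<Xi> j \<gamma>\<close> and the same scalar,
  computed from R alone. V passes the three factors one by one, each lying in the algebra of its
  cover interval, and passes the scalar by linearity.\<close>

lemma intertwines_local_formula:
  assumes "local_factorization a b \<Xi>" "intertwiner A \<rho> \<sigma> V"
    and A: "\<forall>j\<in>{1,2,3}. multiplier_rep R (\<Xi> j \<gamma>) \<in> A (cover_interval a b j)"
  shows "V \<circ> local_formula R a b \<Xi> \<rho> \<gamma> = local_formula R a b \<Xi> \<sigma> \<gamma> \<circ> V"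
proof -
  let ?T = "\<lambda>j. multiplier_rep R (\<Xi> j \<gamma>)" and ?K = "cover_interval a b"
  have V: "V \<in> bounded_ops"
    using assms(2) by (simp add: intertwiner_def)
  have c: "V \<circ> \<rho> (?K j) (?T j) = \<sigma> (?K j) (?T j) \<circ> V" if "j \<in> {1,2,3}" for j
    using assms(2) bspec[OF A that] cover_interval_in_intervals[OF assms(1) that]
    by (auto simp: intertwiner_def)
  have "V \<circ> (\<rho> (?K 1) (?T 1) \<circ> \<rho> (?K 2) (?T 2) \<circ> \<rho> (?K 3) (?T 3))
      = \<sigma> (?K 1) (?T 1) \<circ> \<sigma> (?K 2) (?T 2) \<circ> \<sigma> (?K 3) (?T 3) \<circ> V"
    using c[of 1] c[of 2] c[of 3] by (simp add: fun_eq_iff)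
  then show ?thesis
    by (simp add: local_formula_def Let_def scale_op_o bounded_ops_o_scale_op[OF V])
qed

lemma intertwines_DHR_vir_rep:
  assumes lift: "vir_lift U R"
    and fact: "local_factorization a b \<Xi>"
    and \<rho>: "DHR_vir_rep A R a b \<Xi> \<rho> S\<^sub>\<rho>"
    and \<sigma>: "DHR_vir_rep A R a b \<Xi> \<sigma> S\<^sub>\<sigma>"
    and V: "intertwiner A \<rho> \<sigma> V"
    and \<gamma>: "\<gamma> \<in> Diff_cover"
  shows "V \<circ> multiplier_rep S\<^sub>\<rho> \<gamma> = multiplier_rep S\<^sub>\<sigma> \<gamma> \<circ> V"
proof -
  let ?P = "\<lambda>\<gamma>. V \<circ> multiplier_rep S\<^sub>\<rho> \<gamma> = multiplier_rep S\<^sub>\<sigma> \<gamma> \<circ> V"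
  have rep: "vir_rep S\<^sub>\<rho>" "vir_rep S\<^sub>\<sigma>"
    and scalar: "\<And>s. S\<^sub>\<rho> (s, id) = R (s, id)" "\<And>s. S\<^sub>\<sigma> (s, id) = R (s, id)"
    using \<rho> \<sigma> by (auto simp: DHR_vir_rep_def)
  \<comment> \<open>The lift represents the centre by scalars, with which the linear V
    commutes.\<close>
  have V_scalar: "V \<circ> R (s, id) = R (s, id) \<circ> V" for s
  proof -
    obtain \<mu> where "R (s, id) = scale_op \<mu> id"
      using lift unfolding vir_lift_def by metis
    then show ?thesis
      using V by (simp add: bounded_ops_o_scale_op scale_op_o intertwiner_def)
  qed
  obtain N\<^sub>\<rho> N\<^sub>\<sigma> where N: "openin diff_cover_topology N\<^sub>\<rho>" "openin diff_cover_topology N\<^sub>\<sigma>"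
      "id \<in> N\<^sub>\<rho>" "id \<in> N\<^sub>\<sigma>"
    and N\<^sub>\<rho>: "\<And>\<gamma>. \<gamma> \<in> N\<^sub>\<rho> \<Longrightarrow>
        (\<forall>j\<in>{1,2,3}. multiplier_rep R (\<Xi> j \<gamma>) \<in> A (cover_interval a b j)) \<and>
        multiplier_rep S\<^sub>\<rho> \<gamma> = local_formula R a b \<Xi> \<rho> \<gamma>"
    and N\<^sub>\<sigma>: "\<And>\<gamma>. \<gamma> \<in> N\<^sub>\<sigma> \<Longrightarrow> multiplier_rep S\<^sub>\<sigma> \<gamma> = local_formula R a b \<Xi> \<sigma> \<gamma>"
    using \<rho> \<sigma> unfolding DHR_vir_rep_def by metis
  have local: "?P n" if "n \<in> N\<^sub>\<rho> \<inter> N\<^sub>\<sigma>" for n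
    using that N\<^sub>\<rho>[of n] N\<^sub>\<sigma>[of n] intertwines_local_formula[OF fact V] by simp
  show ?thesis
  proof (rule Diff_cover_neighbourhood_induct[OF \<gamma>, where N = "N\<^sub>\<rho> \<inter> N\<^sub>\<sigma>" and P = ?P])
    show "openin diff_cover_topology (N\<^sub>\<rho> \<inter> N\<^sub>\<sigma>)" "id \<in> N\<^sub>\<rho> \<inter> N\<^sub>\<sigma>"
      using N by auto
    then show "?P id"
      by (intro local)
    fix n g assume n: "n \<in> N\<^sub>\<rho> \<inter> N\<^sub>\<sigma>" and g: "g \<in> Diff_cover"
    have n_cover: "n \<in> Diff_cover"
      using n N(1) by (auto simp: openin_diff_cover diff_open_def)
    let ?Z = "R (bott n g, id)"
    have mult: "multiplier_rep S\<^sub>\<rho> n \<circ> multiplier_rep S\<^sub>\<rho> g = multiplier_rep S\<^sub>\<rho> (n \<circ> g) \<circ> ?Z"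
      "multiplier_rep S\<^sub>\<sigma> n \<circ> multiplier_rep S\<^sub>\<sigma> g = multiplier_rep S\<^sub>\<sigma> (n \<circ> g) \<circ> ?Z"
      using multiplier_rep_mult[OF _ n_cover g] rep scalar by metis+
    have "surj ?Z"
      using lift id_in_Diff_cover by (meson bij_is_surj unitary_bij vir_lift_def vir_rep_unitary)
    have "inj (multiplier_rep S\<^sub>\<sigma> n)"
      unfolding multiplier_rep_def
      using rep n_cover by (meson bij_is_inj unitary_bij vir_rep_unitary)
    \<comment> \<open>\<open>?Z\<close> is appended to turn the values at \<open>n \<circ> g\<close>
      into products. V then moves past the factor at n by the local case, and that factor cancels on
      the left; V itself need not be invertible.\<close>
    have "?P (n \<circ> g) \<longleftrightarrow>
        V \<circ> multiplier_rep S\<^sub>\<rho> (n \<circ> g) \<circ> ?Z = multiplier_rep S\<^sub>\<sigma> (n \<circ> g) \<circ> V \<circ> ?Z"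
      by (simp only: surj_o_cancel[OF \<open>surj ?Z\<close>])
    also have "\<dots> \<longleftrightarrow> V \<circ> (multiplier_rep S\<^sub>\<rho> n \<circ> multiplier_rep S\<^sub>\<rho> g)
        = multiplier_rep S\<^sub>\<sigma> n \<circ> multiplier_rep S\<^sub>\<sigma> g \<circ> V"
      by (simp only: mult V_scalar comp_assoc)
    also have "\<dots> \<longleftrightarrow> multiplier_rep S\<^sub>\<sigma> n \<circ> (V \<circ> multiplier_rep S\<^sub>\<rho> g)
        = multiplier_rep S\<^sub>\<sigma> n \<circ> (multiplier_rep S\<^sub>\<sigma> g \<circ> V)"
      using local[OF n] by (metis comp_assoc)
    also have "\<dots> \<longleftrightarrow> ?P g"
      by (rule inj_o_cancel) fact
    finally show "?P (n \<circ> g) \<longleftrightarrow> ?P g" .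
  qed
qed

section \<open>The cocycle identity and naturality\<close>

lemma covariance_cocycle_identity:
  assumes rep: "vir_rep R" "vir_rep S" and scalar: "\<And>s. S (s, id) = R (s, id)"
    and \<gamma>: "\<gamma>1 \<in> Diff_cover" "\<gamma>2 \<in> Diff_cover"
  defines "T \<equiv> multiplier_rep R" and "z \<equiv> covariance_cocycle (multiplier_rep R) (multiplier_rep S)"
  shows "z (\<gamma>1 \<circ> \<gamma>2) = T \<gamma>1 \<circ> z \<gamma>2 \<circ> cadj (T \<gamma>1) \<circ> z \<gamma>1"
proof -
  let ?S = "multiplier_rep S" and ?Z = "R (bott \<gamma>1 \<gamma>2, id)"
  have bij: "bij (T \<gamma>)" "bij (?S \<gamma>)" "cadj (T \<gamma>) = inv (T \<gamma>)" if "\<gamma> \<in> Diff_cover" for \<gamma>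
    using rep that by (auto simp: T_def multiplier_rep_def unitary_bij cadj_unitary vir_rep_unitary)
  have Z: "bij ?Z"
    using rep by (intro unitary_bij vir_rep_unitary id_in_Diff_cover)
  have \<gamma>12: "\<gamma>1 \<circ> \<gamma>2 \<in> Diff_cover"
    using \<gamma> by (rule Diff_cover_compose)
  have T: "T \<gamma>1 \<circ> T \<gamma>2 = T (\<gamma>1 \<circ> \<gamma>2) \<circ> ?Z" and S: "?S \<gamma>1 \<circ> ?S \<gamma>2 = ?S (\<gamma>1 \<circ> \<gamma>2) \<circ> ?Z"
    using multiplier_rep_mult[OF _ \<gamma>] rep scalar by (metis T_def)+
  \<comment> \<open>Inserting \<open>?Z \<circ> inv ?Z\<close> completes both factors to products,
    since R and S have the same multiplier \<open>?Z\<close>.\<close>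
  have "z (\<gamma>1 \<circ> \<gamma>2) = T (\<gamma>1 \<circ> \<gamma>2) \<circ> (?Z \<circ> inv ?Z) \<circ> inv (?S (\<gamma>1 \<circ> \<gamma>2))"
    using surj_iff[THEN iffD1, OF bij_is_surj[OF Z]]
    by (simp add: z_def T_def covariance_cocycle_eq rep \<gamma>12)
  also have "\<dots> = T \<gamma>1 \<circ> T \<gamma>2 \<circ> inv (?S \<gamma>1 \<circ> ?S \<gamma>2)"
    unfolding T S by (simp add: o_inv_distrib[OF bij(2)[OF \<gamma>12] Z] comp_assoc)
  \<comment> \<open>Inserting \<open>inv (T \<gamma>1) \<circ> T \<gamma>1\<close> between the two
    inverses separates the conjugated cocycle at \<gamma>2 from the cocycle at \<gamma>1.\<close>
  also have "\<dots> = T \<gamma>1 \<circ> (T \<gamma>2 \<circ> inv (?S \<gamma>2)) \<circ> (inv (T \<gamma>1) \<circ> T \<gamma>1) \<circ> inv (?S \<gamma>1)"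
    using bij \<gamma> by (simp add: o_inv_distrib comp_assoc bij_is_inj)
  also have "\<dots> = T \<gamma>1 \<circ> z \<gamma>2 \<circ> cadj (T \<gamma>1) \<circ> z \<gamma>1"
    using bij \<gamma> rep by (simp add: z_def covariance_cocycle_eq comp_assoc T_def)
  finally show ?thesis .
qed

text \<open>On the right the adjoint of \<open>T \<gamma>\<close> cancels against the first factor
  of the cocycle. What remains is the intertwining relation for the inverses of the two unitaries,
  obtained from V by applying it to preimages.\<close>

lemma covariance_cocycle_natural:
  assumes rep: "vir_rep R" "vir_rep S\<^sub>\<rho>" "vir_rep S\<^sub>\<sigma>" and \<gamma>: "\<gamma> \<in> Diff_cover"
    and V: "V \<circ> multiplier_rep S\<^sub>\<rho> \<gamma> = multiplier_rep S\<^sub>\<sigma> \<gamma> \<circ> V"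
  defines "T \<equiv> multiplier_rep R"
  shows "covariance_cocycle T (multiplier_rep S\<^sub>\<sigma>) \<gamma> \<circ> V
    = T \<gamma> \<circ> V \<circ> cadj (T \<gamma>) \<circ> covariance_cocycle T (multiplier_rep S\<^sub>\<rho>) \<gamma>"
proof -
  have bij: "bij (multiplier_rep Q \<gamma>)" if "vir_rep Q" for Q :: "real \<times> (real \<Rightarrow> real) \<Rightarrow> ('a \<Rightarrow> 'a)"
    using that \<gamma> by (simp add: multiplier_rep_def unitary_bij vir_rep_unitary)
  have T: "cadj (T \<gamma>) = inv (T \<gamma>)"
    using rep \<gamma> by (simp add: T_def multiplier_rep_def cadj_unitary vir_rep_unitary)
  have "inv (multiplier_rep S\<^sub>\<sigma> \<gamma>) (V x) = V (inv (multiplier_rep S\<^sub>\<rho> \<gamma>) x)" for x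
  proof (rule inv_f_eq)
    show "inj (multiplier_rep S\<^sub>\<sigma> \<gamma>)"
      using bij[OF rep(3)] by (rule bij_is_inj)
    show "multiplier_rep S\<^sub>\<sigma> \<gamma> (V (inv (multiplier_rep S\<^sub>\<rho> \<gamma>) x)) = V x"
      using fun_cong[OF V, of "inv (multiplier_rep S\<^sub>\<rho> \<gamma>) x"]
      by (simp add: surj_f_inv_f[OF bij_is_surj[OF bij[OF rep(2)]]])
  qed
  moreover have "inv (T \<gamma>) (T \<gamma> x) = x" for x
    using bij[OF rep(1)] by (simp add: T_def bij_is_inj)
  ultimately show ?thesis
    by (simp add: fun_eq_iff covariance_cocycle_eq rep \<gamma> T)
qed

theorem mainTheorem4:
  fixes A :: "complex set \<Rightarrow> ('h::{complex_hilbert, second_countable_topology} \<Rightarrow> 'h) set"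
    and U :: "(complex \<Rightarrow> complex) \<Rightarrow> ('h \<Rightarrow> 'h)"
    and \<Omega> :: 'h
    and \<rho> \<sigma> :: "complex set \<Rightarrow> ('h \<Rightarrow> 'h) \<Rightarrow> ('h \<Rightarrow> 'h)"
    and I1 I2 I :: "complex set"
    and U_vir U_vir\<^sub>\<rho> U_vir\<^sub>\<sigma> :: "real \<times> (real \<Rightarrow> real) \<Rightarrow> ('h \<Rightarrow> 'h)"
    and a b :: "nat \<Rightarrow> real"
    and \<Xi> :: "nat \<Rightarrow> (real \<Rightarrow> real) \<Rightarrow> (real \<Rightarrow> real)"
  assumes "conformal_net A U \<Omega>"
    and "DHR_representation A \<rho>" and "DHR_representation A \<sigma>"
    and "I1 \<in> intervals" and "localized_in A \<rho> I1"
    and "I2 \<in> intervals" and "localized_in A \<sigma> I2"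
    and "I \<in> intervals" and "I1 \<union> I2 \<subseteq> I"
    and "vir_lift U U_vir"
    and "local_factorization a b \<Xi>"
    and "DHR_vir_rep A U_vir a b \<Xi> \<rho> U_vir\<^sub>\<rho>"
    and "DHR_vir_rep A U_vir a b \<Xi> \<sigma> U_vir\<^sub>\<sigma>"
  shows "let T = multiplier_rep U_vir;
             z\<^sub>\<rho> = covariance_cocycle T (multiplier_rep U_vir\<^sub>\<rho>);
             z\<^sub>\<sigma> = covariance_cocycle T (multiplier_rep U_vir\<^sub>\<sigma>)
         in (\<forall>\<gamma>1\<in>Diff_cover. \<forall>\<gamma>2\<in>Diff_cover.
               z\<^sub>\<sigma> (\<gamma>1 \<circ> \<gamma>2) = T \<gamma>1 \<circ> z\<^sub>\<sigma> \<gamma>2 \<circ> cadj (T \<gamma>1) \<circ> z\<^sub>\<sigma> \<gamma>1) \<and>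
            (\<forall>V. intertwiner A \<rho> \<sigma> V \<longrightarrow>
               (\<forall>\<gamma>\<in>Diff_cover. z\<^sub>\<sigma> \<gamma> \<circ> V = (T \<gamma> \<circ> V \<circ> cadj (T \<gamma>)) \<circ> z\<^sub>\<rho> \<gamma>))"
proof -
  have rep: "vir_rep U_vir" "vir_rep U_vir\<^sub>\<rho>" "vir_rep U_vir\<^sub>\<sigma>"
    and scalar: "\<And>s. U_vir\<^sub>\<sigma> (s, id) = U_vir (s, id)"
    using assms by (auto simp: vir_lift_def DHR_vir_rep_def)
  show ?thesis
    unfolding Let_def
    using covariance_cocycle_identity[OF rep(1,3) scalar]
      covariance_cocycle_natural[OF rep]
      intertwines_DHR_vir_rep[OF \<open>vir_lift U U_vir\<close> \<open>local_factorization a b \<Xi>\<close>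
        \<open>DHR_vir_rep A U_vir a b \<Xi> \<rho> U_vir\<^sub>\<rho>\<close> \<open>DHR_vir_rep A U_vir a b \<Xi> \<sigma> U_vir\<^sub>\<sigma>\<close>]
    by blast
qed

end
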